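(* Let $p:\mathbb{R}\to[0,\infty)$ be a probability density function with support $\mathbb{R}$ and distribution function $P$, satisfying the following conditions. (i) $p$ is continuous and positive on $\mathbb{R}$, and there are finitely many points $-\infty<y_1<\dots<y_m<\infty$ ($m\ge 0$) such that $p$ is continuously differentiable on each component interval of $S(p)=\mathbb{R}\setminus\{y_1,\dots,y_m\}$. (ii) $\sup_{x\in S(p)}\left|\frac{p'(x)\min\{P(x),1-P(x)\}}{p^2(x)}\right|<\infty$. (iii) $\int_{S(p)}(1+|x|)\,|p'(x)|\,\mathrm{d}x<\infty$. Let $X:\Omega\to\mathbb{R}$ be a random variable that has a Lebesgue density, with $\mathbb{E}\left|\frac{p'(X)}{p(X)}\right|<\infty$ and $\mathbb{E}\left|\frac{p'(X)}{p(X)}X\right|<\infty$. Then $X$ has Lebesgue density $p$ if, and only if, the density function $\mathfrak{f}_X$ of $X$ (for a suitable version) has the form $$\mathfrak{f}_X(t)=\mathbb{E}\left[\frac{p'(X)}{p(X)}\,\mathbf{1}\{X\le t\}\right],\quad t\in\mathbb{R}.$$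
   Context: $(\Omega,\mathcal{A},\mathbb{P})$ is a probability space and $\mathbf{1}\{\cdot\}$ denotes an indicator. "$X$ has Lebesgue density $p$" means that the law of $X$ is $p\,\mathcal{L}^1$, where $\mathcal{L}^1$ is Lebesgue measure on $\mathbb{R}$. $P(x)=\int_{-\infty}^x p(s)\,\mathrm{d}s$. The case $m=0$ is allowed. Densities are unique only up to $\mathcal{L}^1$-null sets; "for a suitable version" means that the function on the right-hand side is a density function of $X$. *)

theory Defs
  imports "HOL-Probability.Probability"
begin

definition dist_fun :: "(real \<Rightarrow> real) \<Rightarrow> real \<Rightarrow> real" where
  "dist_fun p x = (LBINT s:{..x}. p s)"

text \<open>The law of \<open>X\<close> is \<open>f\<close> times Lebesgue measure. Since \<^const>\<open>ennreal\<close> sends negative reals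
  to 0, \<^const>\<open>distributed\<close> alone would only make the positive part of \<open>f\<close> a density; hence the
  separate almost-everywhere nonnegativity.\<close>

definition has_lebesgue_density :: "'a measure \<Rightarrow> ('a \<Rightarrow> real) \<Rightarrow> (real \<Rightarrow> real) \<Rightarrow> bool" where
  "has_lebesgue_density M X f \<longleftrightarrow>
     f \<in> borel_measurable borel \<and> (AE t in lborel. 0 \<le> f t) \<and>
     distributed M lborel X (\<lambda>t. ennreal (f t))"

end

theory Submission
  imports Defs
begin

text \<open>Write \<open>q = p' / p\<close> for the score function of \<open>p\<close>, and let \<open>f \<ge> 0\<close> be any density of \<open>X\<close>.
  Integrating against the law of \<open>X\<close> turns the right-hand side of the characterization into
  \<open>F t = \<integral>\<^bsub>-\<infinity>\<^esub>\<^sup>t q s f s ds\<close>, with \<open>q f\<close> integrable because \<open>q(X)\<close> is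
  (\<open>expectation_truncated_at_eq_integral\<close>). So the claim is that \<open>p\<close> is the only density solving
  the integrated form of the linear equation \<open>f' = q f\<close>.

  If \<open>f = p\<close>, then \<open>q f = p'\<close>, so that \<open>F - p\<close> is continuous with vanishing derivative off a
  finite set and hence constant. At \<open>-\<infinity>\<close> the function \<open>F\<close> tends to 0, so \<open>p\<close> has a limit there, which
  must be 0 because \<open>p\<close> is integrable (\<open>tendsto_at_bot_imp_zero_of_integrable\<close>). Thus \<open>F = p\<close>.

  If conversely \<open>f = F\<close>, then \<open>f\<close> is continuous, being an indefinite integral, and hence so is
  \<open>q f\<close> off the exceptional points of \<open>p\<close>. There \<open>f' = q f\<close> in the classical sense, and
  \<open>(f / p)' = (f' p - f p') / p\<^sup>2 = 0\<close>. So \<open>f\<close> is a constant multiple of \<open>p\<close>, and both have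
  total mass 1.\<close>

section \<open>Indefinite integrals over half-lines\<close>

lemma set_integrable_of_integrable:
  fixes k :: "real \<Rightarrow> real"
  assumes "integrable lborel k" "A \<in> sets borel"
  shows "set_integrable lborel A k"
  unfolding set_integrable_def using assms by (intro integrable_mult_indicator) auto

lemma set_integral_atMost_split:
  fixes k :: "real \<Rightarrow> real"
  assumes "integrable lborel k" "a \<le> t"
  shows "(LBINT s:{..t}. k s) = (LBINT s:{..a}. k s) + integral {a..t} k"
proof -
  have int: "set_integrable lborel A k" if "A \<in> sets lborel" for A
    using assms(1) that by (simp add: set_integrable_of_integrable)
  have "(LBINT s:{..a} \<union> {a<..t}. k s) = (LBINT s:{..a}. k s) + (LBINT s:{a<..t}. k s)"
    by (intro set_integral_Un int) auto
  moreover have "{..a} \<union> {a<..t} = {..t}"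
    using assms(2) by auto
  moreover have "(LBINT s:{a<..t}. k s) = integral {a<..t} k"
    by (intro set_borel_integral_eq_integral(2) int) auto
  moreover have "integral {a<..t} k = integral {a..t} k"
    by (rule integral_spike_set) (auto intro: negligible_subset[of "{a}"])
  ultimately show ?thesis by simp
qed

lemma continuous_on_set_integral_atMost:
  fixes k :: "real \<Rightarrow> real"
  assumes k: "integrable lborel k"
  shows "continuous_on UNIV (\<lambda>t. LBINT s:{..t}. k s)"
proof -
  have "isCont (\<lambda>t. LBINT s:{..t}. k s) x" for x
  proof -
    have "k integrable_on {x - 1..x + 1}"
      using k by (intro set_borel_integral_eq_integral(1) set_integrable_of_integrable) auto
    then have "continuous_on {x - 1..x + 1}
        (\<lambda>t. (LBINT s:{..x - 1}. k s) + integral {x - 1..t} k)"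
      by (intro continuous_intros indefinite_integral_continuous_1)
    then have "continuous_on {x - 1..x + 1} (\<lambda>t. LBINT s:{..t}. k s)"
      by (rule continuous_on_eq) (simp add: set_integral_atMost_split[OF k, of "x - 1", symmetric])
    then show ?thesis
      by (rule continuous_on_interior) simp
  qed
  then show ?thesis
    by (simp add: continuous_on_eq_continuous_at)
qed

lemma has_real_derivative_set_integral_atMost:
  fixes k :: "real \<Rightarrow> real"
  assumes k: "integrable lborel k" and x: "isCont k x"
  shows "((\<lambda>t. LBINT s:{..t}. k s) has_real_derivative k x) (at x)"
proof -
  have "k integrable_on {x - 1..x + 1}"
    using k by (intro set_borel_integral_eq_integral(1) set_integrable_of_integrable) auto
  then have "((\<lambda>u. integral {x - 1..u} k) has_vector_derivative k x)
      (at x within ({x - 1..x + 1} - {}))"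
    using x by (intro integral_has_vector_derivative_continuous_at)
      (auto intro: continuous_at_imp_continuous_within)
  then have "((\<lambda>u. integral {x - 1..u} k) has_real_derivative k x) (at x within {x - 1..x + 1})"
    by (simp add: has_real_derivative_iff_has_vector_derivative)
  then have "((\<lambda>u. (LBINT s:{..x - 1}. k s) + integral {x - 1..u} k) has_real_derivative k x)
      (at x within {x - 1..x + 1})"
    by (auto intro!: derivative_eq_intros)
  then have "((\<lambda>t. LBINT s:{..t}. k s) has_real_derivative k x) (at x within {x - 1..x + 1})"
    by (rule has_field_derivative_transform_within[where d = 1])
      (auto simp: set_integral_atMost_split[OF k, of "x - 1", symmetric])
  moreover have "at x within {x - 1..x + 1} = at x"
    by (rule at_within_interior) simp
  ultimately show ?thesis by simp
qed

lemma tendsto_set_integral_atMost_at_bot: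
  fixes k :: "real \<Rightarrow> real"
  assumes k: "integrable lborel k"
  shows "((\<lambda>t. LBINT s:{..t}. k s) \<longlongrightarrow> 0) at_bot"
proof (rule tendsto_at_botI_sequentially)
  fix a :: "nat \<Rightarrow> real" assume a: "filterlim a at_bot sequentially"
  have "(\<lambda>n. LINT s|lborel. indicator {..a n} s *\<^sub>R k s) \<longlonglongrightarrow> (LINT s|(lborel :: real measure). 0)"
  proof (rule integral_dominated_convergence)
    show "integrable lborel (\<lambda>s. norm (k s))" using k by simp
    show "AE s in lborel. (\<lambda>n. indicator {..a n} s *\<^sub>R k s) \<longlonglongrightarrow> 0"
    proof (intro AE_I2)
      fix s :: real
      have "\<forall>\<^sub>F n in sequentially. a n < s"
        using a by (simp add: filterlim_at_bot_dense)
      then have "\<forall>\<^sub>F n in sequentially. indicator {..a n} s *\<^sub>R k s = 0"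
        by eventually_elim simp
      then show "(\<lambda>n. indicator {..a n} s *\<^sub>R k s) \<longlonglongrightarrow> 0"
        by (rule tendsto_eventually)
    qed
    show "AE s in lborel. norm (indicator {..a n} s *\<^sub>R k s) \<le> norm (k s)" for n
      by (auto simp: indicator_def)
  qed (use k in \<open>auto intro: borel_measurable_integrable\<close>)
  then show "(\<lambda>n. LBINT s:{..a n}. k s) \<longlonglongrightarrow> 0"
    by (simp add: set_lebesgue_integral_def)
qed

text \<open>Near \<open>-\<infinity>\<close> a function with a nonzero limit \<open>L\<close> has modulus at least \<open>\<bar>L\<bar> / 2\<close> on a set of
  infinite measure.\<close>

lemma tendsto_at_bot_imp_zero_of_integrable:
  fixes p :: "real \<Rightarrow> real"
  assumes p: "integrable lborel p" and L: "(p \<longlongrightarrow> L) at_bot"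
  shows "L = 0"
proof (rule ccontr)
  assume "L \<noteq> 0"
  have "((\<lambda>x. \<bar>p x\<bar>) \<longlongrightarrow> \<bar>L\<bar>) at_bot"
    using L by (rule tendsto_rabs)
  then have "\<forall>\<^sub>F x in at_bot. \<bar>L\<bar> / 2 < \<bar>p x\<bar>"
    by (rule order_tendstoD(1)) (use \<open>L \<noteq> 0\<close> in simp)
  then obtain a where a: "\<And>x. x \<le> a \<Longrightarrow> \<bar>L\<bar> / 2 < \<bar>p x\<bar>"
    by (auto simp: eventually_at_bot_linorder)
  have "integrable lborel (\<lambda>x. \<bar>p x\<bar> * (2 / \<bar>L\<bar>))"
    using p by (intro integrable_mult_left integrable_abs) auto
  then have "integrable lborel (indicator {..a} :: real \<Rightarrow> real)"
  proof (rule Bochner_Integration.integrable_bound)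
    show "AE x in lborel. norm (indicator {..a} x :: real) \<le> norm (\<bar>p x\<bar> * (2 / \<bar>L\<bar>))"
      using a \<open>L \<noteq> 0\<close> by (intro AE_I2) (auto simp: indicator_def field_simps less_imp_le)
  qed auto
  moreover have "emeasure lborel {..a} = \<infinity>"
  proof -
    have "ennreal (real n) \<le> emeasure lborel {..a}" for n :: nat
      using emeasure_mono[of "{a - real n..a}" "{..a}" lborel] by simp
    then have "\<not> emeasure lborel {..a} < top"
      using ennreal_Ex_less_of_nat[of "emeasure lborel {..a}"]
      by (auto simp: ennreal_of_nat_eq_real_of_nat not_less[symmetric])
    then show ?thesis
      by (simp add: top.not_eq_extremum[symmetric])
  qed
  ultimately show False
    by (simp add: integrable_indicator_iff)
qed

section \<open>The score function under a density\<close>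

text \<open>For \<open>g = p'\<close> and \<open>Y\<close> the exceptional points, where \<^const>\<open>deriv\<close> takes unspecified values,
  this makes the score function measurable.\<close>

lemma borel_measurable_of_continuous_off_countable:
  fixes g :: "real \<Rightarrow> real"
  assumes "countable Y" "open (- Y)" "continuous_on (- Y) g"
  shows "g \<in> borel_measurable borel"
proof (rule measurable_discrete_difference)
  show "(\<lambda>x. indicator (- Y) x *\<^sub>R g x) \<in> borel_measurable borel"
    using assms by (intro borel_measurable_continuous_on_indicator) auto
qed (use assms in auto)

lemma C1_differentiable_on_imp_deriv:
  fixes p :: "real \<Rightarrow> real"
  assumes "p C1_differentiable_on S"
  shows "\<And>x. x \<in> S \<Longrightarrow> (p has_real_derivative deriv p x) (at x)"
    and "continuous_on S (deriv p)"
proof -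
  obtain D where D: "\<And>x. x \<in> S \<Longrightarrow> (p has_real_derivative D x) (at x)" "continuous_on S D"
    using assms
    by (auto simp: C1_differentiable_on_def has_real_derivative_iff_has_vector_derivative)
  have eq: "deriv p x = D x" if "x \<in> S" for x
    using D(1)[OF that] by (rule DERIV_imp_deriv)
  show "(p has_real_derivative deriv p x) (at x)" if "x \<in> S" for x
    using D(1)[OF that] eq[OF that] by simp
  show "continuous_on S (deriv p)"
    using D(2) eq by (simp cong: continuous_on_cong)
qed

lemma expectation_truncated_at_eq_integral:
  fixes M :: "'a measure" and X :: "'a \<Rightarrow> real" and q f :: "real \<Rightarrow> real"
  assumes X: "distributed M lborel X (\<lambda>t. ennreal (f t))" and f: "\<And>t. 0 \<le> f t"
    and q: "q \<in> borel_measurable borel" and int: "integrable M (\<lambda>\<omega>. q (X \<omega>))"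
  shows "integrable lborel (\<lambda>s. f s * q s)"
    and "(LINT \<omega>|M. q (X \<omega>) * indicator {\<omega>'. X \<omega>' \<le> t} \<omega>) = (LBINT s:{..t}. f s * q s)"
proof -
  show "integrable lborel (\<lambda>s. f s * q s)"
    using distributed_integrable[OF X, of q] f q int by simp
  have "(LINT \<omega>|M. q (X \<omega>) * indicator {\<omega>'. X \<omega>' \<le> t} \<omega>)
      = (LINT \<omega>|M. (\<lambda>s. q s * indicator {..t} s) (X \<omega>))"
    by (simp add: indicator_def)
  also have "\<dots> = (LINT s|lborel. f s * (q s * indicator {..t} s))"
    by (rule distributed_integral[OF X, symmetric]) (use f q in auto)
  also have "\<dots> = (LBINT s:{..t}. f s * q s)"
    by (simp add: set_lebesgue_integral_def ac_simps)
  finally show "(LINT \<omega>|M. q (X \<omega>) * indicator {\<omega>'. X \<omega>' \<le> t} \<omega>) = (LBINT s:{..t}. f s * q s)" .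
qed

section \<open>The integral equation for a density\<close>

lemma eq_set_integral_deriv_of_integrable:
  fixes p :: "real \<Rightarrow> real"
  assumes Y: "finite Y" and cont: "continuous_on UNIV p" and C1: "p C1_differentiable_on (- Y)"
    and p: "integrable lborel p" and p': "integrable lborel (deriv p)"
  shows "p t = (LBINT s:{..t}. deriv p s)"
proof -
  define F where "F = (\<lambda>t. LBINT s:{..t}. deriv p s)"
  have "isCont (deriv p) x" if "x \<in> - Y" for x
    using C1_differentiable_on_imp_deriv(2)[OF C1] that Y
    by (simp add: continuous_on_eq_continuous_at open_Compl finite_imp_closed)
  then have "((\<lambda>t. p t - F t) has_real_derivative 0) (at x)" if "x \<in> - Y" for x
    using C1_differentiable_on_imp_deriv(1)[OF C1] that unfolding F_def
    by (auto intro!: derivative_eq_intros has_real_derivative_set_integral_atMost[OF p'])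
  moreover have "continuous_on UNIV (\<lambda>t. p t - F t)"
    unfolding F_def by (intro continuous_intros cont continuous_on_set_integral_atMost p')
  ultimately have "(\<lambda>t. p t - F t) constant_on UNIV"
    using Y by (intro DERIV_zero_connected_constant_on[of UNIV Y]) auto
  then obtain c where c: "\<And>t. p t - F t = c"
    by (auto simp: constant_on_def)
  then have "p = (\<lambda>t. c + F t)"
    by (simp add: fun_eq_iff diff_eq_eq)
  moreover have "((\<lambda>t. c + F t) \<longlongrightarrow> c + 0) at_bot"
    unfolding F_def by (intro tendsto_intros tendsto_set_integral_atMost_at_bot p')
  ultimately have "(p \<longlongrightarrow> c) at_bot" by simp
  then have "c = 0"
    by (rule tendsto_at_bot_imp_zero_of_integrable[OF p])
  with c[of t] show ?thesis by (simp add: F_def)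
qed

text \<open>The equation \<open>f = \<integral> f p' / p\<close> is first order and linear with solution \<open>p\<close>, so every other solution
  is a multiple of it. Integrability of the right-hand side gives the continuity of \<open>f\<close> that is
  needed to differentiate.\<close>

lemma score_equation_imp_scalar_multiple:
  fixes p f :: "real \<Rightarrow> real"
  assumes Y: "finite Y" and cont: "continuous_on UNIV p" and C1: "p C1_differentiable_on (- Y)"
    and pos: "\<And>x. 0 < p x"
    and int: "integrable lborel (\<lambda>s. f s * (deriv p s / p s))"
    and eq: "\<And>t. f t = (LBINT s:{..t}. f s * (deriv p s / p s))"
  obtains c where "\<And>t. f t = c * p t"
proof -
  have f_eq: "f = (\<lambda>t. LBINT s:{..t}. f s * (deriv p s / p s))"
    using eq by (rule ext)
  have f_cont: "continuous_on UNIV f"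
    by (subst f_eq) (rule continuous_on_set_integral_atMost[OF int])
  have f_deriv: "(f has_real_derivative f x * (deriv p x / p x)) (at x)" if "x \<in> - Y" for x
  proof -
    have "isCont (deriv p) x"
      using C1_differentiable_on_imp_deriv(2)[OF C1] that Y
      by (simp add: continuous_on_eq_continuous_at open_Compl finite_imp_closed)
    moreover have "isCont f x" "isCont p x"
      using f_cont cont by (simp_all add: continuous_on_eq_continuous_at)
    ultimately have "isCont (\<lambda>s. f s * (deriv p s / p s)) x"
      using pos[of x] by (intro continuous_intros) auto
    from has_real_derivative_set_integral_atMost[OF int this] show ?thesis
      by (subst f_eq)
  qed
  have "((\<lambda>t. f t / p t) has_real_derivative 0) (at x)" if "x \<in> - Y" for x
    using f_deriv[OF that] C1_differentiable_on_imp_deriv(1)[OF C1 that] pos[of x]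
    by (auto intro!: derivative_eq_intros simp: field_simps)
  moreover have "continuous_on UNIV (\<lambda>t. f t / p t)"
    using pos by (intro continuous_intros f_cont cont) (simp add: less_imp_neq[symmetric])
  ultimately have "(\<lambda>t. f t / p t) constant_on UNIV"
    using Y by (intro DERIV_zero_connected_constant_on[of UNIV Y]) auto
  then obtain c where c: "\<And>t. f t / p t = c"
    by (auto simp: constant_on_def)
  have "f t = c * p t" for t
    using c[of t] pos[of t] by (simp add: divide_eq_eq)
  then show thesis by (rule that)
qed

section \<open>The characterization\<close>

theorem corollary4p3:
  fixes M :: "'a measure" and X :: "'a \<Rightarrow> real"
    and p :: "real \<Rightarrow> real" and Y :: "real set"
  assumes "prob_space M"
    and p_nonneg: "\<And>x. 0 \<le> p x"
    and p_prob: "has_bochner_integral lborel p 1"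
    and p_support: "closure {x. 0 < p x} = UNIV"
    and i_cont: "continuous_on UNIV p"
    and i_pos: "\<And>x. 0 < p x"
    and i_finite: "finite Y"
    and i_C1: "p C1_differentiable_on (- Y)"
    and ii: "bdd_above ((\<lambda>x. \<bar>deriv p x * min (dist_fun p x) (1 - dist_fun p x) / (p x)\<^sup>2\<bar>) ` (- Y))"
    and iii: "set_integrable lborel (- Y) (\<lambda>x. (1 + \<bar>x\<bar>) * \<bar>deriv p x\<bar>)"
    and X_rv: "X \<in> borel_measurable M"
    and X_density: "\<exists>f. has_lebesgue_density M X f"
    and X_int1: "integrable M (\<lambda>\<omega>. deriv p (X \<omega>) / p (X \<omega>))"
    and X_int2: "integrable M (\<lambda>\<omega>. deriv p (X \<omega>) / p (X \<omega>) * X \<omega>)"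
  shows "has_lebesgue_density M X p \<longleftrightarrow>
    (\<exists>f. has_lebesgue_density M X f \<and>
      (\<forall>t. f t = (LINT \<omega>|M. deriv p (X \<omega>) / p (X \<omega>) * indicator {\<omega>'. X \<omega>' \<le> t} \<omega>)))"
proof -
  interpret prob_space M by fact
  define q where "q = (\<lambda>x. deriv p x / p x)"
  have p_meas: "p \<in> borel_measurable borel"
    using i_cont by (rule borel_measurable_continuous_onI)
  have "deriv p \<in> borel_measurable borel"
    using i_finite C1_differentiable_on_imp_deriv(2)[OF i_C1]
    by (intro borel_measurable_of_continuous_off_countable[of Y])
      (auto simp: countable_finite open_Compl finite_imp_closed)
  then have q_meas: "q \<in> borel_measurable borel"
    unfolding q_def using p_meas by simp
  have q_int: "integrable M (\<lambda>\<omega>. q (X \<omega>))"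
    using X_int1 by (simp add: q_def)
  have p_int: "integrable lborel p" "(LINT x|lborel. p x) = 1"
    using p_prob by (auto simp: has_bochner_integral_iff)
  show ?thesis
  proof
    assume X: "has_lebesgue_density M X p"
    then have D: "distributed M lborel X (\<lambda>t. ennreal (p t))"
      by (simp add: has_lebesgue_density_def)
    have pq: "(\<lambda>s. p s * q s) = deriv p"
      using i_pos by (auto simp: q_def fun_eq_iff less_imp_neq[symmetric])
    note repr = expectation_truncated_at_eq_integral[OF D p_nonneg q_meas q_int, unfolded pq]
    have "p t = (LINT \<omega>|M. q (X \<omega>) * indicator {\<omega>'. X \<omega>' \<le> t} \<omega>)" for t
      unfolding repr(2)
      by (rule eq_set_integral_deriv_of_integrable[OF i_finite i_cont i_C1 p_int(1) repr(1)])
    then show "\<exists>f. has_lebesgue_density M X f \<and>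
        (\<forall>t. f t = (LINT \<omega>|M. deriv p (X \<omega>) / p (X \<omega>) * indicator {\<omega>'. X \<omega>' \<le> t} \<omega>))"
      using X unfolding q_def by blast
  next
    assume "\<exists>f. has_lebesgue_density M X f \<and>
        (\<forall>t. f t = (LINT \<omega>|M. deriv p (X \<omega>) / p (X \<omega>) * indicator {\<omega>'. X \<omega>' \<le> t} \<omega>))"
    then obtain f where X: "has_lebesgue_density M X f"
      and f: "\<And>t. f t = (LINT \<omega>|M. q (X \<omega>) * indicator {\<omega>'. X \<omega>' \<le> t} \<omega>)"
      by (auto simp: q_def)
    have f_meas: "f \<in> borel_measurable borel" and f_AE: "AE t in lborel. 0 \<le> f t"
      using X by (simp_all add: has_lebesgue_density_def)
    \<comment> \<open>Until \<open>f\<close> is known to be a multiple of \<open>p\<close>, it is nonnegative only almost everywhere, so its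
      positive part is the density used to rewrite expectations.\<close>
    have D: "distributed M lborel X (\<lambda>t. ennreal (max 0 (f t)))"
    proof -
      have "(\<lambda>t. ennreal (max 0 (f t))) = (\<lambda>t. ennreal (f t))"
        by (auto simp: max_def ennreal_neg)
      with X show ?thesis by (simp add: has_lebesgue_density_def)
    qed
    note repr = expectation_truncated_at_eq_integral[OF D _ q_meas q_int, simplified]
    have f_max: "AE t in lborel. max 0 (f t) * q t = f t * q t"
      using f_AE by eventually_elim simp
    have fq_int: "integrable lborel (\<lambda>s. f s * q s)"
      by (rule integrable_cong_AE_imp[OF repr(1)]) (use f_max f_meas q_meas in auto)
    have f_eq: "f t = (LBINT s:{..t}. f s * q s)" for t
      unfolding f[of t] repr(2) set_lebesgue_integral_def
      using f_max f_meas q_meas by (intro integral_cong_AE) auto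
    obtain c where c: "\<And>t. f t = c * p t"
      using score_equation_imp_scalar_multiple[OF i_finite i_cont i_C1 i_pos
          fq_int[unfolded q_def] f_eq[unfolded q_def]] by blast
    have "(LINT t|lborel. max 0 (f t)) = 1"
      using distributed_integral[OF D, of "\<lambda>_. 1"] by (simp add: prob_space)
    moreover have "(LINT t|lborel. max 0 (f t)) = (LINT t|lborel. f t)"
      using f_AE f_meas by (intro integral_cong_AE) auto
    ultimately have "c = 1"
      using p_int(2) by (simp add: c)
    with c have "f = p" by auto
    with X show "has_lebesgue_density M X p" by simp
  qed
qed

end
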